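(* Let $T>0$, $\varepsilon>0$, let $\Omega\subset\mathbb{R}^m$ be compact and $\Gamma\subset\Omega$ closed with $\Omega\setminus\Gamma$ open, let $\tilde\Omega\subset\Omega$ be a finite set and $\tilde\Gamma\subset\tilde\Omega$ a non-empty subset with $\tilde\Omega\setminus\tilde\Gamma\subset\Omega\setminus\Gamma$, and let $\tilde P:\tilde\Omega\setminus\tilde\Gamma\to[0,\infty)$ and $\tilde\psi:\tilde\Omega\to\mathbb{R}$ be Lipschitz. Let $g:[0,\infty)\to[0,\infty)$ be such that there is $r_g>0$ with $\mathrm{supp}(g)\subset[0,r_g]$, and there is $a\in(0,r_g)$ such that $g$ is decreasing on $[0,a]$ and $g(a)>0$. Assume that there exists a Lipschitz function $\tilde\psi_b:\Omega\to\mathbb{R}$ with $\tilde\psi_b=\tilde\psi$ on $\tilde\Gamma$ such that $(u,t)\mapsto\tilde\psi_b(u)$ is a viscosity sub-solution of problem $(\mathcal{P}_\varepsilon)$ in $\tilde\Omega_T$. Then problem $(\mathcal{P}_\varepsilon)$ admits a unique viscosity solution $f^\varepsilon$ in $\tilde\Omega_T$, and $f^\varepsilon$ is in fact continuous. Moreover, there exists a Lipschitz function $\bar f^\varepsilon:\tilde\Omega_T\to\mathbb{R}$ such that $$\tilde\psi_b(u)\le f^\varepsilon(u,t)\le\bar f^\varepsilon(u,t)\qquad\text{for all }(u,t)\in\tilde\Omega_T.$$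
   Context: $|\cdot|$ is the Euclidean norm. $\tilde\Omega_T=\tilde\Omega\times[0,T]$ and $\partial\tilde\Omega_T=(\tilde\Gamma\times(0,T))\cup(\tilde\Omega\times\{0\})$. Kernel: $C_g=\sup_{t\ge0}t\,g(t)$, taken to satisfy $0<C_g<\infty$, and $J_\varepsilon(u,v)=\frac{1}{\varepsilon C_g}\,g\!\left(\frac{|u-v|}{\varepsilon}\right)$. For a function $h$ on $\tilde\Omega_T$, $$|\nabla^-_{J_\varepsilon}h(u,t)|_\infty=\max_{v\in\tilde\Omega}J_\varepsilon(u,v)\,(h(u,t)-h(v,t)).$$ Problem $(\mathcal{P}_\varepsilon)$ is: $\partial_t f^\varepsilon(u,t)=-|\nabla^-_{J_\varepsilon}f^\varepsilon(u,t)|_\infty+\tilde P(u)$ for $(u,t)\in(\tilde\Omega\setminus\tilde\Gamma)\times(0,T)$, and $f^\varepsilon(u,t)=\tilde\psi(u)$ for $(u,t)\in\partial\tilde\Omega_T$. Viscosity solutions of $(\mathcal{P}_\varepsilon)$. An upper semicontinuous $h:\tilde\Omega_T\to\mathbb{R}$ is a viscosity sub-solution in $(\tilde\Omega\setminus\tilde\Gamma)\times(0,T)$ if for all $(u_0,t_0)\in(\tilde\Omega\setminus\tilde\Gamma)\times(0,T)$ and $\varphi\in C^1((0,T))$ such that $h(u_0,\cdot)-\varphi$ has a local maximum at $t_0$, one has $\varphi'(t_0)\le-|\nabla^-_{J_\varepsilon}h(u_0,t_0)|_\infty+\tilde P(u_0)$; it is a viscosity sub-solution in $\tilde\Omega_T$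 if moreover $h(u,t)\le\tilde\psi(u)$ on $\partial\tilde\Omega_T$. A lower semicontinuous $h$ is a viscosity super-solution in $(\tilde\Omega\setminus\tilde\Gamma)\times(0,T)$ if for all such $(u_0,t_0)$, $\varphi$ with $h(u_0,\cdot)-\varphi$ having a local minimum at $t_0$, $\varphi'(t_0)\ge-|\nabla^-_{J_\varepsilon}h(u_0,t_0)|_\infty+\tilde P(u_0)$; it is a viscosity super-solution in $\tilde\Omega_T$ if moreover $h(u,t)\ge\tilde\psi(u)$ on $\partial\tilde\Omega_T$. A locally bounded $h:\tilde\Omega_T\to\mathbb{R}$ is a viscosity solution in $\tilde\Omega_T$ if its upper (resp. lower) semicontinuous envelope $h^*$ (resp. $h_*$) is a viscosity sub-solution (resp. super-solution) in $\tilde\Omega_T$.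
   Formalization: Since nothing constrains a viscosity solution at t=T, uniqueness and continuity at T fail literally; here a solution continuous on [0,T] exists, every viscosity solution agrees with it for t<T, and every continuous one agrees with it also at t=T. *)

theory Defs
  imports "HOL-Analysis.Analysis"
begin

section \<open>The kernel and the nonlocal gradient\<close>

definition kernel_const :: "(real \<Rightarrow> real) \<Rightarrow> real" where
  "kernel_const g = (SUP t\<in>{0..}. t * g t)"

definition kernel :: "(real \<Rightarrow> real) \<Rightarrow> real \<Rightarrow> 'a::euclidean_space \<Rightarrow> 'a \<Rightarrow> real" where
  "kernel g \<epsilon> u v = 1 / (\<epsilon> * kernel_const g) * g (norm (u - v) / \<epsilon>)"

definition nonlocal_grad ::
  "(real \<Rightarrow> real) \<Rightarrow> real \<Rightarrow> 'a::euclidean_space set \<Rightarrow> ('a \<times> real \<Rightarrow> real) \<Rightarrow> 'a \<Rightarrow> real \<Rightarrow> real" where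
  "nonlocal_grad g \<epsilon> X h u t = Max ((\<lambda>v. kernel g \<epsilon> u v * (h (u, t) - h (v, t))) ` X)"

section \<open>The space-time domain\<close>

definition cylinder :: "'a set \<Rightarrow> real \<Rightarrow> ('a \<times> real) set" where
  "cylinder X T = X \<times> {0..T}"

text \<open>The terminal time is not part of the parabolic boundary: no data are prescribed at \<open>t = T\<close>,
  not even on \<open>B\<close>.\<close>

definition parabolic_boundary :: "'a set \<Rightarrow> 'a set \<Rightarrow> real \<Rightarrow> ('a \<times> real) set" where
  "parabolic_boundary X B T = (B \<times> {0<..<T}) \<union> (X \<times> {0})"

section \<open>Semicontinuity and semicontinuous envelopes\<close>

definition usc_on :: "'b::topological_space set \<Rightarrow> ('b \<Rightarrow> real) \<Rightarrow> bool" where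
  "usc_on S f \<longleftrightarrow> (\<forall>z\<in>S. \<forall>c > f z. \<forall>\<^sub>F w in at z within S. f w < c)"

definition lsc_on :: "'b::topological_space set \<Rightarrow> ('b \<Rightarrow> real) \<Rightarrow> bool" where
  "lsc_on S f \<longleftrightarrow> (\<forall>z\<in>S. \<forall>c < f z. \<forall>\<^sub>F w in at z within S. c < f w)"

definition locally_bounded_on :: "'b::metric_space set \<Rightarrow> ('b \<Rightarrow> real) \<Rightarrow> bool" where
  "locally_bounded_on S f \<longleftrightarrow> (\<forall>z\<in>S. \<exists>\<delta>>0. bounded (f ` (S \<inter> ball z \<delta>)))"

text \<open>The suprema and infima are taken in the extended reals, because a locally bounded function
  may be unbounded on large balls. At points of \<open>S\<close> the result is finite when \<open>f\<close> is locally
  bounded on \<open>S\<close>. The balls are not punctured, so that \<open>f\<close> lies between its envelopes on \<open>S\<close>.\<close>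

definition upper_envelope :: "'b::metric_space set \<Rightarrow> ('b \<Rightarrow> real) \<Rightarrow> 'b \<Rightarrow> real" where
  "upper_envelope S f z =
     real_of_ereal (INF \<delta>\<in>{0<..}. SUP w\<in>S \<inter> ball z \<delta>. ereal (f w))"

definition lower_envelope :: "'b::metric_space set \<Rightarrow> ('b \<Rightarrow> real) \<Rightarrow> 'b \<Rightarrow> real" where
  "lower_envelope S f z =
     real_of_ereal (SUP \<delta>\<in>{0<..}. INF w\<in>S \<inter> ball z \<delta>. ereal (f w))"

section \<open>Viscosity solutions\<close>

text \<open>The problem has the spatial domain \<open>X\<close> with boundary part \<open>B\<close>, the time horizon \<open>T\<close>, the
  right-hand side \<open>P\<close> on \<open>X - B\<close> and the boundary and initial datum \<open>\<psi>\<close> on \<open>X\<close>.\<close>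

definition visc_subsol_interior ::
  "'a::euclidean_space set \<Rightarrow> 'a set \<Rightarrow> real \<Rightarrow> (real \<Rightarrow> real) \<Rightarrow> real \<Rightarrow> ('a \<Rightarrow> real)
    \<Rightarrow> ('a \<times> real \<Rightarrow> real) \<Rightarrow> bool" where
  "visc_subsol_interior X B T g \<epsilon> P h \<longleftrightarrow>
     usc_on (cylinder X T) h \<and>
     (\<forall>u\<in>X - B. \<forall>t\<in>{0<..<T}. \<forall>\<phi>. \<phi> C1_differentiable_on {0<..<T} \<and>
        (\<forall>\<^sub>F s in nhds t. h (u, s) - \<phi> s \<le> h (u, t) - \<phi> t) \<longrightarrow>
        deriv \<phi> t \<le> - nonlocal_grad g \<epsilon> X h u t + P u)"

definition visc_supersol_interior ::
  "'a::euclidean_space set \<Rightarrow> 'a set \<Rightarrow> real \<Rightarrow> (real \<Rightarrow> real) \<Rightarrow> real \<Rightarrow> ('a \<Rightarrow> real)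
    \<Rightarrow> ('a \<times> real \<Rightarrow> real) \<Rightarrow> bool" where
  "visc_supersol_interior X B T g \<epsilon> P h \<longleftrightarrow>
     lsc_on (cylinder X T) h \<and>
     (\<forall>u\<in>X - B. \<forall>t\<in>{0<..<T}. \<forall>\<phi>. \<phi> C1_differentiable_on {0<..<T} \<and>
        (\<forall>\<^sub>F s in nhds t. h (u, s) - \<phi> s \<ge> h (u, t) - \<phi> t) \<longrightarrow>
        deriv \<phi> t \<ge> - nonlocal_grad g \<epsilon> X h u t + P u)"

definition visc_subsol ::
  "'a::euclidean_space set \<Rightarrow> 'a set \<Rightarrow> real \<Rightarrow> (real \<Rightarrow> real) \<Rightarrow> real \<Rightarrow> ('a \<Rightarrow> real) \<Rightarrow> ('a \<Rightarrow> real)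
    \<Rightarrow> ('a \<times> real \<Rightarrow> real) \<Rightarrow> bool" where
  "visc_subsol X B T g \<epsilon> P \<psi> h \<longleftrightarrow>
     visc_subsol_interior X B T g \<epsilon> P h \<and>
     (\<forall>(u, t)\<in>parabolic_boundary X B T. h (u, t) \<le> \<psi> u)"

definition visc_supersol ::
  "'a::euclidean_space set \<Rightarrow> 'a set \<Rightarrow> real \<Rightarrow> (real \<Rightarrow> real) \<Rightarrow> real \<Rightarrow> ('a \<Rightarrow> real) \<Rightarrow> ('a \<Rightarrow> real)
    \<Rightarrow> ('a \<times> real \<Rightarrow> real) \<Rightarrow> bool" where
  "visc_supersol X B T g \<epsilon> P \<psi> h \<longleftrightarrow>
     visc_supersol_interior X B T g \<epsilon> P h \<and>
     (\<forall>(u, t)\<in>parabolic_boundary X B T. h (u, t) \<ge> \<psi> u)"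

text \<open>The definition puts no condition on \<open>h\<close> at \<open>t = T\<close> beyond local boundedness: test functions
  are only applied in \<open>(0, T)\<close>. Hence a solution is determined on \<open>X \<times> [0, T)\<close> only, and
  its values at \<open>t = T\<close> are determined once it is required to be continuous up to \<open>T\<close>.\<close>

definition visc_solution ::
  "'a::euclidean_space set \<Rightarrow> 'a set \<Rightarrow> real \<Rightarrow> (real \<Rightarrow> real) \<Rightarrow> real \<Rightarrow> ('a \<Rightarrow> real) \<Rightarrow> ('a \<Rightarrow> real)
    \<Rightarrow> ('a \<times> real \<Rightarrow> real) \<Rightarrow> bool" where
  "visc_solution X B T g \<epsilon> P \<psi> h \<longleftrightarrow>
     locally_bounded_on (cylinder X T) h \<and>
     visc_subsol X B T g \<epsilon> P \<psi> (upper_envelope (cylinder X T) h) \<and>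
     visc_supersol X B T g \<epsilon> P \<psi> (lower_envelope (cylinder X T) h)"

end

theory Submission
  imports Defs
begin

text \<open>
  Since \<open>X\<close> is finite, the problem is a system of ordinary differential equations: one unknown
  function of time for each point of \<open>X - B\<close>, with prescribed constants on \<open>B\<close>. Its right-hand side
  depends on the unknowns through a maximum of finitely many linear functions, so it is globally
  Lipschitz, and Picard iteration gives a classical solution on the whole of \<open>[0, T]\<close>
  (\<open>ex_classical_solution\<close>). This solution is continuously differentiable in time, so it equals its
  own envelopes, and it is a viscosity solution because at an extremum of \<open>f (u, \<cdot>) - \<phi>\<close> the
  derivatives agree.

  Everything else follows from comparing semicontinuous sub- and super-solutions with this one
  regular solution \<open>f\<close>, which can itself serve in the test function. If a
  sub-solution \<open>h\<close> exceeds \<open>f\<close> somewhere before \<open>T\<close>, let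
  \<open>K > 0\<close> be the maximum of \<open>(T - t) (h - f)\<close> over the cylinder. Then
  \<open>h \<le> f + K / (T - t)\<close> with equality at some point \<open>(u\<^sub>0,
  t\<^sub>0)\<close>, which lies off the parabolic boundary. The test function \<open>f
  (u\<^sub>0, \<cdot>) + K / (T - \<cdot>)\<close> touches \<open>h (u\<^sub>0, \<cdot>)\<close>
  from above there, and the nonlocal gradient of \<open>h\<close> at this point is at least that
  of \<open>f\<close>, because the kernel is nonnegative and \<open>h - f\<close> is largest at
  \<open>u\<^sub>0\<close> among all points of \<open>X\<close> at time \<open>t\<^sub>0\<close>.
  The sub-solution inequality then forces \<open>K / (T - t\<^sub>0)\<^sup>2 \<le> 0\<close>, a
  contradiction (\<open>subsol_le_classical_solution\<close>; the bound from below is symmetric).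
  The weight \<open>T - t\<close> keeps the maximum away from \<open>t = T\<close>, where the
  equation says nothing.

  For a viscosity solution \<open>h\<close> this gives \<open>h\<^sup>* \<le> f \<le> h\<^sub>*\<close> before \<open>T\<close>, hence \<open>h = f\<close> there. The lower
  barrier \<open>\<psi>b\<close> is below \<open>f\<close> by the same comparison. As \<open>f\<close> is continuous on a compact set, the upper
  barrier can be taken constant.
\<close>

section \<open>Semicontinuous functions and their envelopes\<close>

lemma lsc_on_iff_usc_on_uminus: "lsc_on S f \<longleftrightarrow> usc_on S (\<lambda>z. - f z)"
  unfolding lsc_on_def usc_on_def
proof (intro iffI ballI allI impI)
  fix z c
  assume "\<forall>z\<in>S. \<forall>c<f z. \<forall>\<^sub>F w in at z within S. c < f w" "z \<in> S" "- f z < c"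
  then have "\<forall>\<^sub>F w in at z within S. - c < f w"
    by (metis minus_less_iff)
  then show "\<forall>\<^sub>F w in at z within S. - f w < c"
    by eventually_elim auto
next
  fix z c
  assume "\<forall>z\<in>S. \<forall>c>- f z. \<forall>\<^sub>F w in at z within S. - f w < c" "z \<in> S" "c < f z"
  then have "\<forall>\<^sub>F w in at z within S. - f w < - c"
    by (meson neg_less_iff_less)
  then show "\<forall>\<^sub>F w in at z within S. c < f w"
    by eventually_elim auto
qed

lemma continuous_on_imp_usc_on: "continuous_on S f \<Longrightarrow> usc_on S f"
  unfolding usc_on_def continuous_on_def by (metis order_tendstoD(2))

lemma usc_on_add:
  assumes "usc_on S f" "usc_on S g"
  shows "usc_on S (\<lambda>z. f z + g z)"
  unfolding usc_on_def
proof (intro ballI allI impI)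
  fix z c assume z: "z \<in> S" and c: "f z + g z < c"
  define e where "e = (c - f z - g z) / 2"
  have "e > 0" using c by (simp add: e_def)
  then have "\<forall>\<^sub>F w in at z within S. f w < f z + e" "\<forall>\<^sub>F w in at z within S. g w < g z + e"
    using assms z unfolding usc_on_def by auto
  then show "\<forall>\<^sub>F w in at z within S. f w + g w < c"
    by eventually_elim (simp add: e_def field_simps)
qed

lemma usc_on_mult_nonneg:
  assumes w: "continuous_on S w" "\<And>z. z \<in> S \<Longrightarrow> w z \<ge> 0" and d: "usc_on S d"
  shows "usc_on S (\<lambda>z. w z * d z)"
  unfolding usc_on_def
proof (intro ballI allI impI)
  fix z c assume z: "z \<in> S" and c: "w z * d z < c"
  \<comment> \<open>A strict upper bound \<open>b\<close> for \<open>d z\<close> that still satisfies \<open>w z * b < c\<close>; it exists even if \<open>w z = 0\<close>.\<close>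
  obtain b where b: "d z < b" "w z * b < c"
  proof -
    define b where "b = d z + (c - w z * d z) / (w z + 1)"
    have p: "w z + 1 > 0" using w(2)[OF z] by simp
    have "d z < b" using p c by (simp add: b_def)
    moreover have "w z * b = w z * d z + (c - w z * d z) * (w z / (w z + 1))"
      by (simp add: b_def algebra_simps)
    moreover have "(c - w z * d z) * (w z / (w z + 1)) < (c - w z * d z) * 1"
      using p c by (intro mult_strict_left_mono) (auto simp: field_simps)
    ultimately show ?thesis using that[of b] by simp
  qed
  have "((\<lambda>y. w y * b) \<longlongrightarrow> w z * b) (at z within S)"
    using w(1) z by (intro tendsto_intros) (auto simp: continuous_on_def)
  then have "\<forall>\<^sub>F y in at z within S. w y * b < c"
    using b(2) by (rule order_tendstoD)
  moreover have "\<forall>\<^sub>F y in at z within S. d y < b"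
    using d z b(1) unfolding usc_on_def by auto
  moreover have "\<forall>\<^sub>F y in at z within S. y \<in> S"
    by (simp add: eventually_at_filter)
  ultimately show "\<forall>\<^sub>F y in at z within S. w y * d y < c"
  proof eventually_elim
    case (elim y)
    have "w y * d y \<le> w y * b" using elim w(2) by (intro mult_left_mono) auto
    then show ?case using elim by simp
  qed
qed

lemma usc_on_attains_sup:
  assumes "compact S" "S \<noteq> {}" and f: "usc_on S f"
  obtains z where "z \<in> S" "\<And>w. w \<in> S \<Longrightarrow> f w \<le> f z"
proof (rule ccontr)
  \<comment> \<open>Without a maximum, the relatively open sets \<open>{f < f w}\<close> cover \<open>S\<close>; in a finite subcover the set
    with the largest \<open>f w\<close> would have to contain its own \<open>w\<close>.\<close>
  assume "\<not> thesis"
  then have nomax: "\<forall>z\<in>S. \<exists>w\<in>S. f z < f w"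
    using that by (meson not_le)
  define U where "U w = {y \<in> S. f y < f w}" for w
  have "openin (top_of_set S) (U w)" for w
  proof (subst openin_subopen, intro ballI)
    fix z assume z: "z \<in> U w"
    then have "\<forall>\<^sub>F y in at z within S. f y < f w"
      using f unfolding usc_on_def U_def by auto
    then obtain A where "open A" "z \<in> A" "\<And>y. y \<in> A \<Longrightarrow> y \<in> S \<Longrightarrow> y \<noteq> z \<Longrightarrow> f y < f w"
      unfolding eventually_at_topological by auto
    then show "\<exists>A. openin (top_of_set S) A \<and> z \<in> A \<and> A \<subseteq> U w"
      using z by (intro exI[of _ "S \<inter> A"]) (auto simp: U_def openin_open_Int)
  qed
  moreover have "S \<subseteq> \<Union>(U ` S)"
    using nomax by (auto simp: U_def)
  ultimately obtain D where D: "D \<subseteq> U ` S" "finite D" "S \<subseteq> \<Union>D"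
    using \<open>compact S\<close> unfolding compact_eq_openin_cover by (metis (no_types, lifting) imageE)
  then obtain W where W: "W \<subseteq> S" "finite W" "D = U ` W"
    by (meson finite_subset_image)
  with D \<open>S \<noteq> {}\<close> have "W \<noteq> {}" by auto
  then have "Max (f ` W) \<in> f ` W" using W by (intro Max_in) auto
  then obtain w where w: "w \<in> W" "f w = Max (f ` W)" by auto
  then obtain y where "y \<in> W" "w \<in> U y" using D W by auto
  then have "f w < f y" "f y \<le> Max (f ` W)" using W by (auto simp: U_def)
  with w show False by simp
qed

lemma lower_envelope_eq_uminus_upper_envelope:
  "lower_envelope S f z = - upper_envelope S (\<lambda>w. - f w) z"
proof -
  have "(SUP \<delta>\<in>{0<..}. INF w\<in>S \<inter> ball z \<delta>. ereal (f w))
      = - (INF \<delta>\<in>{0<..}. SUP w\<in>S \<inter> ball z \<delta>. - ereal (f w))"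
    by (simp only: ereal_SUP_uminus_eq ereal_INF_uminus_eq ereal_uminus_uminus)
  then show ?thesis
    by (simp add: lower_envelope_def upper_envelope_def)
qed

lemma upper_envelope_ge:
  assumes "locally_bounded_on S f" "z \<in> S"
  shows "f z \<le> upper_envelope S f z"
proof -
  let ?E = "INF \<delta>\<in>{0<..}. SUP w\<in>S \<inter> ball z \<delta>. ereal (f w)"
  have ge: "ereal (f z) \<le> ?E"
    using assms(2) by (intro INF_greatest SUP_upper) auto
  obtain \<delta> where "\<delta> > 0" "bounded (f ` (S \<inter> ball z \<delta>))"
    using assms unfolding locally_bounded_on_def by blast
  then obtain M where M: "\<And>w. w \<in> S \<inter> ball z \<delta> \<Longrightarrow> \<bar>f w\<bar> \<le> M"
    unfolding bounded_iff by (metis imageI real_norm_def)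
  have "?E \<le> (SUP w\<in>S \<inter> ball z \<delta>. ereal (f w))"
    using \<open>\<delta> > 0\<close> by (intro INF_lower) auto
  also have "\<dots> \<le> ereal M"
    using M by (intro SUP_least) force
  finally have "?E \<le> ereal M" .
  with ge have "ereal (real_of_ereal ?E) = ?E"
    by (cases ?E) auto
  with ge show ?thesis
    unfolding upper_envelope_def by (metis ereal_less_eq(3))
qed

lemma lower_envelope_le:
  assumes "locally_bounded_on S f" "z \<in> S"
  shows "lower_envelope S f z \<le> f z"
proof -
  have "(\<lambda>w. - f w) ` A = uminus ` f ` A" for A
    by (simp add: image_image)
  then have "locally_bounded_on S (\<lambda>w. - f w)"
    using assms(1) unfolding locally_bounded_on_def by (metis bounded_uminus)
  from upper_envelope_ge[OF this assms(2)] show ?thesis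
    by (simp add: lower_envelope_eq_uminus_upper_envelope)
qed

lemma upper_envelope_continuous:
  assumes "continuous_on S f" "z \<in> S"
  shows "upper_envelope S f z = f z"
proof -
  let ?E = "INF \<delta>\<in>{0<..}. SUP w\<in>S \<inter> ball z \<delta>. ereal (f w)"
  have "?E = ereal (f z)"
  proof (rule antisym)
    show "ereal (f z) \<le> ?E"
      using assms(2) by (intro INF_greatest SUP_upper) auto
    show "?E \<le> ereal (f z)"
    proof (rule ereal_le_epsilon2)
      fix e :: real assume "0 < e"
      then obtain \<delta> where \<delta>: "\<delta> > 0" "\<And>w. w \<in> S \<Longrightarrow> dist w z < \<delta> \<Longrightarrow> dist (f w) (f z) < e"
        using assms unfolding continuous_on_iff by blast
      have "?E \<le> (SUP w\<in>S \<inter> ball z \<delta>. ereal (f w))"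
        using \<delta> by (intro INF_lower) auto
      also have "\<dots> \<le> ereal (f z) + ereal e"
        using \<delta>(2) by (intro SUP_least) (force simp: dist_real_def dist_commute)
      finally show "?E \<le> ereal (f z) + ereal e" .
    qed
  qed
  then show ?thesis unfolding upper_envelope_def by simp
qed

lemma lower_envelope_continuous:
  assumes "continuous_on S f" "z \<in> S"
  shows "lower_envelope S f z = f z"
  using upper_envelope_continuous[of S "\<lambda>w. - f w" z] assms
  by (simp add: lower_envelope_eq_uminus_upper_envelope continuous_on_minus)

lemma continuous_on_imp_locally_bounded_on:
  assumes "continuous_on S f"
  shows "locally_bounded_on S f"
  unfolding locally_bounded_on_def
proof
  fix z assume "z \<in> S"
  then obtain \<delta> where \<delta>: "\<delta> > 0" "\<And>w. w \<in> S \<Longrightarrow> dist w z < \<delta> \<Longrightarrow> dist (f w) (f z) < 1"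
    using assms unfolding continuous_on_iff by (meson zero_less_one)
  then have "f ` (S \<inter> ball z \<delta>) \<subseteq> ball (f z) 1"
    by (auto simp: dist_commute)
  then show "\<exists>\<delta>>0. bounded (f ` (S \<inter> ball z \<delta>))"
    using \<delta>(1) bounded_subset[OF bounded_ball] by blast
qed

section \<open>Finite systems of ordinary differential equations\<close>

lemma continuous_on_lipschitz_field:
  fixes F :: "('i \<Rightarrow> real) \<Rightarrow> real" and y :: "'i \<Rightarrow> real \<Rightarrow> real"
  assumes "finite X" "L \<ge> 0"
    and lip: "\<And>y z M. (\<forall>v\<in>X. \<bar>y v - z v\<bar> \<le> M) \<Longrightarrow> \<bar>F y - F z\<bar> \<le> L * M"
    and y: "\<And>v. v \<in> X \<Longrightarrow> continuous_on S (y v)"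
  shows "continuous_on S (\<lambda>s. F (\<lambda>v. y v s))"
  unfolding continuous_on_def
proof (intro ballI tendstoI)
  fix s and e :: real assume s: "s \<in> S" and "0 < e"
  then have e: "e / (L + 1) > 0" "L * (e / (L + 1)) < e"
    using \<open>L \<ge> 0\<close> by (auto simp: field_simps)
  have "\<forall>\<^sub>F x in at s within S. dist (y v x) (y v s) < e / (L + 1)" if "v \<in> X" for v
    using y[OF that] s e(1) unfolding continuous_on_def by (auto dest: tendstoD)
  then have "\<forall>\<^sub>F x in at s within S. \<forall>v\<in>X. dist (y v x) (y v s) < e / (L + 1)"
    using \<open>finite X\<close> by (simp add: eventually_ball_finite)
  then show "\<forall>\<^sub>F x in at s within S. dist (F (\<lambda>v. y v x)) (F (\<lambda>v. y v s)) < e"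
  proof eventually_elim
    case (elim x)
    then have "\<bar>F (\<lambda>v. y v x) - F (\<lambda>v. y v s)\<bar> \<le> L * (e / (L + 1))"
      by (intro lip) (auto simp: dist_real_def less_imp_le)
    then show ?case using e(2) by (simp add: dist_real_def)
  qed
qed

text \<open>
  Picard iteration, started at the constant \<open>y0\<close>. If \<open>C\<close> bounds the field at \<open>y0\<close>, consecutive
  iterates differ by at most \<open>C T 2\<^sup>-\<^sup>n e\<^sup>2\<^sup>L\<^sup>t\<close> at time \<open>t\<close>: relative to the exponential weight the
  integral operator is a contraction with factor \<open>1/2\<close>, however long the interval is, so the iterates
  converge uniformly on all of \<open>[0, T]\<close>.
\<close>

lemma picard_finite_system:
  fixes F :: "'i \<Rightarrow> ('i \<Rightarrow> real) \<Rightarrow> real" and y0 :: "'i \<Rightarrow> real"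
  assumes fin: "finite X" and L: "L \<ge> 0" and T: "T \<ge> 0"
    and lip: "\<And>u y z M. u \<in> X \<Longrightarrow> (\<forall>v\<in>X. \<bar>y v - z v\<bar> \<le> M) \<Longrightarrow> \<bar>F u y - F u z\<bar> \<le> L * M"
  obtains f where "\<And>u. u \<in> X \<Longrightarrow> f u 0 = y0 u"
    and "\<And>u t. u \<in> X \<Longrightarrow> t \<in> {0..T} \<Longrightarrow>
      (f u has_real_derivative F u (\<lambda>v. f v t)) (at t within {0..T})"
proof -
  define p where "p = rec_nat (\<lambda>u (t::real). y0 u) (\<lambda>_ q u t. y0 u + integral {0..t} (\<lambda>s. F u (\<lambda>v. q v s)))"
  have p0: "p 0 u t = y0 u" for u t
    by (simp add: p_def)
  have pSuc: "p (Suc n) u t = y0 u + integral {0..t} (\<lambda>s. F u (\<lambda>v. p n v s))" for n u t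
    by (simp add: p_def)
  have contF: "continuous_on S (\<lambda>s. F u (\<lambda>v. y v s))"
    if "u \<in> X" "\<And>v. v \<in> X \<Longrightarrow> continuous_on S (y v)" for u S and y :: "'i \<Rightarrow> real \<Rightarrow> real"
    using fin L lip[OF that(1)] that(2) by (rule continuous_on_lipschitz_field)
  have contp: "continuous_on {0..T} (p n u)" if "u \<in> X" for n u
    using that
  proof (induction n arbitrary: u)
    case 0
    then show ?case by (simp add: p0[abs_def])
  next
    case (Suc n)
    have "(\<lambda>s. F u (\<lambda>v. p n v s)) integrable_on {0..T}"
      using contF[of u "{0..T}" "p n"] Suc by (intro integrable_continuous_interval) auto
    then show ?case
      unfolding pSuc[abs_def] by (intro continuous_intros indefinite_integral_continuous_1)
  qed
  have intF: "(\<lambda>s. F u (\<lambda>v. p n v s)) integrable_on {0..t}" if "u \<in> X" "t \<in> {0..T}" for u n t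
  proof (intro integrable_continuous_interval contF that(1))
    show "continuous_on {0..t} (p n v)" if "v \<in> X" for v
      using contp[OF that] by (rule continuous_on_subset) (use \<open>t \<in> {0..T}\<close> in auto)
  qed
  define C where "C = (\<Sum>u\<in>X. \<bar>F u y0\<bar>)"
  have C: "\<bar>F u y0\<bar> \<le> C" if "u \<in> X" for u
    unfolding C_def using that fin by (intro member_le_sum) auto
  have C0: "C \<ge> 0" by (simp add: C_def sum_nonneg)
  define K where "K n = C * T * (1 / 2) ^ n" for n :: nat
  have K0: "K n \<ge> 0" for n using C0 T by (simp add: K_def)
  have diff: "\<bar>p (Suc n) u t - p n u t\<bar> \<le> K n * exp (2 * L * t)" if "u \<in> X" "t \<in> {0..T}" for n u t
    using that
  proof (induction n arbitrary: u t)
    case 0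
    have "\<bar>p (Suc 0) u t - p 0 u t\<bar> = t * \<bar>F u y0\<bar>"
      using 0 by (simp add: p0 pSuc abs_mult)
    also have "\<dots> \<le> T * C"
      using 0 C C0 by (intro mult_mono) auto
    also have "\<dots> \<le> C * T * exp (2 * L * t)"
      using 0 C0 T L mult_left_mono[of 1 "exp (2 * L * t)" "C * T"] by (simp add: mult.commute)
    finally show ?case by (simp add: K_def)
  next
    case (Suc n)
    let ?G = "\<lambda>s. F u (\<lambda>v. p (Suc n) v s) - F u (\<lambda>v. p n v s)"
    have int: "((\<lambda>s. L * (K n * exp (2 * L * s))) has_integral
        K n / 2 * exp (2 * L * t) - K n / 2 * exp (2 * L * 0)) {0..t}"
      using Suc.prems(2)
      by (intro fundamental_theorem_of_calculus)
        (auto intro!: derivative_eq_intros simp flip: has_real_derivative_iff_has_vector_derivative)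
    have "\<bar>p (Suc (Suc n)) u t - p (Suc n) u t\<bar> = norm (integral {0..t} ?G)"
      unfolding pSuc[of "Suc n"] pSuc[of n u t] using intF Suc.prems by (simp add: integral_diff)
    also have "\<dots> \<le> integral {0..t} (\<lambda>s. L * (K n * exp (2 * L * s)))"
    proof (rule integral_norm_bound_integral)
      show "?G integrable_on {0..t}" using intF Suc.prems by (intro integrable_diff) auto
      show "(\<lambda>s. L * (K n * exp (2 * L * s))) integrable_on {0..t}" using int by blast
      fix s assume "s \<in> {0..t}"
      then show "norm (?G s) \<le> L * (K n * exp (2 * L * s))"
        using Suc.IH[of _ s] Suc.prems lip by auto
    qed
    also have "\<dots> \<le> K n / 2 * exp (2 * L * t)"
      using integral_unique[OF int] K0[of n] by simp
    finally show ?case by (simp add: K_def)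
  qed
  define f where "f u t = y0 u + (\<Sum>n. p (Suc n) u t - p n u t)" for u t
  have lim: "uniform_limit {0..T} (\<lambda>n. p n u) (f u) sequentially" if "u \<in> X" for u
  proof -
    have "uniform_limit {0..T} (\<lambda>N t. \<Sum>n<N. p (Suc n) u t - p n u t)
        (\<lambda>t. \<Sum>n. p (Suc n) u t - p n u t) sequentially"
    proof (rule Weierstrass_m_test)
      fix n t assume t: "t \<in> {0..T}"
      have "K n * exp (2 * L * t) \<le> K n * exp (2 * L * T)"
        using t K0 L by (intro mult_left_mono) (auto intro!: mult_left_mono)
      then show "norm (p (Suc n) u t - p n u t) \<le> K n * exp (2 * L * T)"
        using diff[OF that t, of n] by simp
    next
      show "summable (\<lambda>n. K n * exp (2 * L * T))"
        unfolding K_def by (intro summable_mult2 summable_mult summable_geometric) auto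
    qed
    moreover have "(\<Sum>n<N. p (Suc n) u t - p n u t) = p N u t - y0 u" for N t
      using sum_lessThan_telescope[of "\<lambda>n. p n u t" N] by (simp add: p0)
    ultimately have "uniform_limit {0..T} (\<lambda>N t. p N u t - y0 u) (\<lambda>t. f u t - y0 u) sequentially"
      by (simp add: f_def)
    then show ?thesis
      by (simp add: uniform_limit_iff dist_real_def)
  qed
  have contf: "continuous_on {0..T} (f u)" if "u \<in> X" for u
    using contp[OF that] lim[OF that] by (intro uniform_limit_theorem[of _ "\<lambda>n. p n u"]) auto
  have eq: "f u t = y0 u + integral {0..t} (\<lambda>s. F u (\<lambda>v. f v s))" if u: "u \<in> X" and t: "t \<in> {0..T}" for u t
  proof -
    have "uniform_limit {0..t} (\<lambda>n s. F u (\<lambda>v. p n v s)) (\<lambda>s. F u (\<lambda>v. f v s)) sequentially"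
    proof (rule uniform_limitI)
      fix e :: real assume "0 < e"
      then have e: "e / (L + 1) > 0" "L * (e / (L + 1)) < e"
        using L by (auto simp: field_simps)
      have "\<forall>\<^sub>F n in sequentially. \<forall>v\<in>X. \<forall>s\<in>{0..T}. dist (p n v s) (f v s) < e / (L + 1)"
        using lim e(1) fin by (intro eventually_ball_finite) (auto dest: uniform_limitD)
      then show "\<forall>\<^sub>F n in sequentially. \<forall>s\<in>{0..t}. dist (F u (\<lambda>v. p n v s)) (F u (\<lambda>v. f v s)) < e"
      proof eventually_elim
        case (elim n)
        show ?case
        proof
          fix s assume "s \<in> {0..t}"
          then have "\<bar>F u (\<lambda>v. p n v s) - F u (\<lambda>v. f v s)\<bar> \<le> L * (e / (L + 1))"
            using elim t by (intro lip[OF u]) (auto simp: dist_real_def less_imp_le)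
          then show "dist (F u (\<lambda>v. p n v s)) (F u (\<lambda>v. f v s)) < e"
            using e(2) by (simp add: dist_real_def)
        qed
      qed
    qed
    moreover have "continuous_on {0..t} (\<lambda>s. F u (\<lambda>v. p n v s))" for n
    proof (rule contF[OF u])
      show "continuous_on {0..t} (p n v)" if "v \<in> X" for v
        using contp[OF that] by (rule continuous_on_subset) (use t in auto)
    qed
    ultimately obtain I J where IJ: "\<And>n. ((\<lambda>s. F u (\<lambda>v. p n v s)) has_integral I n) {0..t}"
        "((\<lambda>s. F u (\<lambda>v. f v s)) has_integral J) {0..t}" "I \<longlonglongrightarrow> J"
      by (rule uniform_limit_integral) auto
    have "(\<lambda>n. p (Suc n) u t) \<longlonglongrightarrow> y0 u + J"
      unfolding pSuc integral_unique[OF IJ(1)] by (intro tendsto_intros IJ(3))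
    moreover have "(\<lambda>n. p (Suc n) u t) \<longlonglongrightarrow> f u t"
      using tendsto_uniform_limitI[OF lim[OF u] t] by (rule LIMSEQ_Suc)
    ultimately show ?thesis
      using LIMSEQ_unique integral_unique[OF IJ(2)] by blast
  qed
  show thesis
  proof (rule that)
    show "f u 0 = y0 u" if "u \<in> X" for u
      using eq[OF that, of 0] T by simp
    fix u t assume u: "u \<in> X" and t: "t \<in> {0..T}"
    have "((\<lambda>x. y0 u + integral {0..x} (\<lambda>s. F u (\<lambda>v. f v s))) has_real_derivative
        0 + F u (\<lambda>v. f v t)) (at t within {0..T})"
      using u t contf by (intro derivative_intros integral_has_real_derivative contF)
    then show "(f u has_real_derivative F u (\<lambda>v. f v t)) (at t within {0..T})"
      using eq[OF u] t by (auto elim!: has_field_derivative_transform_within[where d = 1])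
  qed
qed

section \<open>Classical solutions\<close>

lemma abs_Max_diff_le:
  fixes a b :: "'i \<Rightarrow> real"
  assumes "finite X" "X \<noteq> {}" and "\<And>v. v \<in> X \<Longrightarrow> \<bar>a v - b v\<bar> \<le> D"
  shows "\<bar>Max (a ` X) - Max (b ` X)\<bar> \<le> D"
proof -
  have *: "Max (a ` X) \<le> Max (b ` X) + D" if "\<And>v. v \<in> X \<Longrightarrow> a v \<le> b v + D" for a b
  proof (rule Max.boundedI)
    fix x assume "x \<in> a ` X"
    then obtain v where "v \<in> X" "x = a v" by auto
    then show "x \<le> Max (b ` X) + D"
      using that[of v] Max_ge[of "b ` X" "b v"] assms(1) by (auto intro: order_trans)
  qed (use assms(1,2) in auto)
  show ?thesis
    using *[of a b] *[of b a] assms(3) by (force simp: abs_le_iff)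
qed

lemma nonlocal_grad_mono:
  assumes "finite X" "X \<noteq> {}" and "\<And>v. v \<in> X \<Longrightarrow> kernel g \<epsilon> u v \<ge> 0"
    and "\<And>v. v \<in> X \<Longrightarrow> h (u, t) - h (v, t) \<le> k (u, t) - k (v, t)"
  shows "nonlocal_grad g \<epsilon> X h u t \<le> nonlocal_grad g \<epsilon> X k u t"
  unfolding nonlocal_grad_def
proof (rule Max.boundedI)
  fix x assume "x \<in> (\<lambda>v. kernel g \<epsilon> u v * (h (u, t) - h (v, t))) ` X"
  then obtain v where v: "v \<in> X" "x = kernel g \<epsilon> u v * (h (u, t) - h (v, t))" by auto
  then have "x \<le> kernel g \<epsilon> u v * (k (u, t) - k (v, t))"
    using assms(3,4) by (auto intro: mult_left_mono)
  also have "\<dots> \<le> Max ((\<lambda>v. kernel g \<epsilon> u v * (k (u, t) - k (v, t))) ` X)"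
    using v assms(1) by (intro Max_ge) auto
  finally show "x \<le> Max ((\<lambda>v. kernel g \<epsilon> u v * (k (u, t) - k (v, t))) ` X)" .
qed (use assms in auto)

text \<open>The one-sided derivative at \<open>t = T\<close> and the boundary values at \<open>t = T\<close> are included so that a
  classical solution is continuous up to the final time.\<close>

definition classical_solution ::
  "'a::euclidean_space set \<Rightarrow> 'a set \<Rightarrow> real \<Rightarrow> (real \<Rightarrow> real) \<Rightarrow> real \<Rightarrow> ('a \<Rightarrow> real) \<Rightarrow> ('a \<Rightarrow> real)
    \<Rightarrow> ('a \<times> real \<Rightarrow> real) \<Rightarrow> bool" where
  "classical_solution X B T g \<epsilon> P \<psi> f \<longleftrightarrow>
     (\<forall>u\<in>X. f (u, 0) = \<psi> u) \<and>
     (\<forall>u\<in>B. \<forall>t\<in>{0..T}. f (u, t) = \<psi> u) \<and>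
     (\<forall>u\<in>X - B. \<forall>t\<in>{0..T}. ((\<lambda>s. f (u, s)) has_real_derivative
        - nonlocal_grad g \<epsilon> X f u t + P u) (at t within {0..T}))"

lemma ex_classical_solution:
  fixes X B :: "'a::euclidean_space set"
  assumes "finite X" "X \<noteq> {}" "B \<subseteq> X" "T > 0"
  shows "\<exists>f. classical_solution X B T g \<epsilon> P \<psi> f"
proof -
  \<comment> \<open>On \<open>B\<close> the vector field vanishes, so that the boundary values stay frozen at \<open>\<psi>\<close>.\<close>
  define F where "F u y = (if u \<in> B then 0
    else - Max ((\<lambda>v. kernel g \<epsilon> u v * (y u - y v)) ` X) + P u)" for u and y :: "'a \<Rightarrow> real"
  define L where "L = 2 * (\<Sum>u\<in>X. \<Sum>v\<in>X. \<bar>kernel g \<epsilon> u v\<bar>)"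
  have kernel_le: "2 * \<bar>kernel g \<epsilon> u v\<bar> \<le> L" if "u \<in> X" "v \<in> X" for u v
  proof -
    have "\<bar>kernel g \<epsilon> u v\<bar> \<le> (\<Sum>v\<in>X. \<bar>kernel g \<epsilon> u v\<bar>)"
      using assms(1) that by (intro member_le_sum) auto
    also have "\<dots> \<le> (\<Sum>u\<in>X. \<Sum>v\<in>X. \<bar>kernel g \<epsilon> u v\<bar>)"
      using assms(1) that by (intro member_le_sum sum_nonneg) (auto intro: sum_nonneg)
    finally show ?thesis by (simp add: L_def)
  qed
  have L0: "L \<ge> 0" by (simp add: L_def sum_nonneg)
  have lip: "\<bar>F u y - F u z\<bar> \<le> L * M"
    if u: "u \<in> X" and M: "\<forall>v\<in>X. \<bar>y v - z v\<bar> \<le> M" for u y z M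
  proof (cases "u \<in> B")
    case True
    then show ?thesis using L0 M u by (auto simp: F_def intro: mult_nonneg_nonneg order_trans[OF abs_ge_zero])
  next
    case False
    have M0: "M \<ge> 0" using M u by (auto intro: order_trans[OF abs_ge_zero])
    have "\<bar>Max ((\<lambda>v. kernel g \<epsilon> u v * (y u - y v)) ` X) - Max ((\<lambda>v. kernel g \<epsilon> u v * (z u - z v)) ` X)\<bar> \<le> L * M"
    proof (rule abs_Max_diff_le[OF assms(1,2)])
      fix v assume v: "v \<in> X"
      have "\<bar>kernel g \<epsilon> u v * (y u - y v) - kernel g \<epsilon> u v * (z u - z v)\<bar>
          = \<bar>kernel g \<epsilon> u v\<bar> * \<bar>(y u - z u) - (y v - z v)\<bar>"
        by (simp add: abs_mult[symmetric] algebra_simps)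
      also have "\<dots> \<le> \<bar>kernel g \<epsilon> u v\<bar> * (2 * M)"
        using bspec[OF M u] bspec[OF M v] by (intro mult_left_mono) linarith+
      also have "\<dots> \<le> L * M"
        using mult_right_mono[OF kernel_le[OF u v] M0] by (simp add: mult_ac)
      finally show "\<bar>kernel g \<epsilon> u v * (y u - y v) - kernel g \<epsilon> u v * (z u - z v)\<bar> \<le> L * M" .
    qed
    then show ?thesis using False by (simp add: F_def abs_minus_commute)
  qed
  obtain f where f0: "\<And>u. u \<in> X \<Longrightarrow> f u 0 = \<psi> u"
    and f': "\<And>u t. u \<in> X \<Longrightarrow> t \<in> {0..T} \<Longrightarrow>
      (f u has_real_derivative F u (\<lambda>v. f v t)) (at t within {0..T})"
    by (rule picard_finite_system[where F = F and ?y0.0 = \<psi>,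
          OF assms(1) L0 less_imp_le[OF \<open>T > 0\<close>] lip]) blast+
  have "f u t = \<psi> u" if "u \<in> B" "t \<in> {0..T}" for u t
  proof -
    have "(f u has_derivative (\<lambda>h. 0)) (at s within {0..T})" if "s \<in> {0..T}" for s
      using f'[of u s] \<open>u \<in> B\<close> \<open>B \<subseteq> X\<close> that by (auto simp: F_def has_field_derivative_def lambda_zero)
    then have "f u t = f u 0"
      using that(2) \<open>T > 0\<close> has_derivative_zero_unique[of "{0..T}" "f u" t 0] by auto
    then show ?thesis using f0 \<open>u \<in> B\<close> \<open>B \<subseteq> X\<close> by auto
  qed
  moreover have "(f u has_real_derivative
      - Max ((\<lambda>v. kernel g \<epsilon> u v * (f u t - f v t)) ` X) + P u) (at t within {0..T})"
    if "u \<in> X - B" "t \<in> {0..T}" for u t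
    using f'[of u t] that by (simp add: F_def)
  ultimately have "classical_solution X B T g \<epsilon> P \<psi> (\<lambda>(u, t). f u t)"
    using f0 by (simp add: classical_solution_def nonlocal_grad_def)
  then show ?thesis by blast
qed

lemma classical_solution_continuous_on:
  fixes X B :: "'a::euclidean_space set"
  assumes "finite X" and f: "classical_solution X B T g \<epsilon> P \<psi> f"
  shows "continuous_on (cylinder X T) f"
proof -
  have time: "continuous_on {0..T} (\<lambda>s. f (u, s))" if "u \<in> X" for u
  proof (cases "u \<in> B")
    case True
    then have "continuous_on {0..T} (\<lambda>s. f (u, s)) \<longleftrightarrow> continuous_on {0..T} (\<lambda>s. \<psi> u)"
      using f by (intro continuous_on_cong) (auto simp: classical_solution_def)
    then show ?thesis by simp
  next
    case False
    then show ?thesis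
      using f that unfolding classical_solution_def
      by (intro DERIV_continuous_on[of _ _ "\<lambda>t. - nonlocal_grad g \<epsilon> X f u t + P u"]) auto
  qed
  have "continuous_on ({u} \<times> {0..T}) f" if "u \<in> X" for u
  proof -
    have "continuous_on ({u} \<times> {0..T}) (\<lambda>z. f (u, snd z))"
      using time[OF that] by (rule continuous_on_compose2) (auto intro: continuous_intros)
    moreover have "continuous_on ({u} \<times> {0..T}) f \<longleftrightarrow> continuous_on ({u} \<times> {0..T}) (\<lambda>z. f (u, snd z))"
      by (intro continuous_on_cong) auto
    ultimately show ?thesis by simp
  qed
  then have "continuous_on (\<Union>u\<in>X. {u} \<times> {0..T}) f"
    using assms(1) by (intro continuous_on_closed_Union) (auto intro: closed_Times)
  moreover have "(\<Union>u\<in>X. {u} \<times> {0..T}) = cylinder X T" by (auto simp: cylinder_def)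
  ultimately show ?thesis by simp
qed

lemma continuous_on_Max_image:
  fixes F :: "'i \<Rightarrow> 'b::topological_space \<Rightarrow> real"
  assumes "finite X" "X \<noteq> {}" "\<And>v. v \<in> X \<Longrightarrow> continuous_on S (F v)"
  shows "continuous_on S (\<lambda>s. Max ((\<lambda>v. F v s) ` X))"
  using assms by (induction X rule: finite_ne_induct) (auto intro: continuous_on_max)

lemma continuous_on_nonlocal_grad:
  fixes X :: "'a::euclidean_space set"
  assumes "finite X" and f: "continuous_on (cylinder X T) f" and "u \<in> X"
  shows "continuous_on {0..T} (\<lambda>s. nonlocal_grad g \<epsilon> X f u s)"
proof -
  have "continuous_on {0..T} (\<lambda>s. f (v, s))" if "v \<in> X" for v
    using f by (rule continuous_on_compose2) (use that in \<open>auto simp: cylinder_def intro: continuous_intros\<close>)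
  then show ?thesis
    unfolding nonlocal_grad_def using assms
    by (intro continuous_on_Max_image continuous_intros) auto
qed

lemma classical_solution_deriv:
  assumes "classical_solution X B T g \<epsilon> P \<psi> f" "u \<in> X - B" "t \<in> {0<..<T}"
  shows "((\<lambda>s. f (u, s)) has_real_derivative - nonlocal_grad g \<epsilon> X f u t + P u) (at t)"
proof -
  have "((\<lambda>s. f (u, s)) has_real_derivative - nonlocal_grad g \<epsilon> X f u t + P u) (at t within {0..T})"
    using assms unfolding classical_solution_def by auto
  then show ?thesis using assms(3) by (simp add: at_within_Icc_at)
qed

text \<open>The test functions of the comparison argument. The penalty \<open>K / (T - s)\<close> adds the definite
  amount \<open>K / (T - t)\<^sup>2\<close> to the time derivative; \<open>K\<close> is positive for sub-solutions and negative for
  super-solutions.\<close>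

lemma penalised_classical_solution:
  fixes X B :: "'a::euclidean_space set" and K :: real
  assumes "finite X" and f: "classical_solution X B T g \<epsilon> P \<psi> f" and u: "u \<in> X - B"
  defines "\<phi> \<equiv> \<lambda>s. f (u, s) + K / (T - s)"
  shows "\<phi> C1_differentiable_on {0<..<T}"
    and "t \<in> {0<..<T} \<Longrightarrow>
      deriv \<phi> t = - nonlocal_grad g \<epsilon> X f u t + P u + K / (T - t)\<^sup>2"
proof -
  define D where "D s = - nonlocal_grad g \<epsilon> X f u s + P u + K / (T - s)\<^sup>2" for s
  have D: "(\<phi> has_real_derivative D s) (at s)" if "s \<in> {0<..<T}" for s
    unfolding \<phi>_def D_def using that
    by (intro DERIV_add classical_solution_deriv[OF f u])
      (auto intro!: derivative_eq_intros simp: power2_eq_square)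
  have "continuous_on {0..T} (\<lambda>s. nonlocal_grad g \<epsilon> X f u s)"
    using u by (intro continuous_on_nonlocal_grad classical_solution_continuous_on[OF _ f] assms(1)) auto
  then have "continuous_on {0<..<T} (\<lambda>s. nonlocal_grad g \<epsilon> X f u s)"
    by (rule continuous_on_subset) auto
  then have "continuous_on {0<..<T} D"
    unfolding D_def by (intro continuous_intros) auto
  then show "\<phi> C1_differentiable_on {0<..<T}"
    using D unfolding C1_differentiable_on_def has_real_derivative_iff_has_vector_derivative by blast
  show "deriv \<phi> t = - nonlocal_grad g \<epsilon> X f u t + P u + K / (T - t)\<^sup>2" if "t \<in> {0<..<T}"
    using DERIV_imp_deriv[OF D[OF that]] by (simp add: D_def)
qed

lemma C1_real_has_derivative:
  fixes \<phi> :: "real \<Rightarrow> real"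
  assumes "\<phi> C1_differentiable_on S" "t \<in> S"
  shows "(\<phi> has_real_derivative deriv \<phi> t) (at t)"
  using assms unfolding C1_differentiable_on_def has_real_derivative_iff_has_vector_derivative[symmetric]
  by (metis DERIV_imp_deriv)

lemma DERIV_eq_0_at_local_max:
  fixes d :: "real \<Rightarrow> real"
  assumes "(d has_real_derivative l) (at t)" "\<forall>\<^sub>F s in nhds t. d s \<le> d t"
  shows "l = 0"
proof -
  obtain e where "e > 0" "\<And>s. dist s t < e \<Longrightarrow> d s \<le> d t"
    using assms(2) unfolding eventually_nhds_metric by blast
  then show ?thesis
    using DERIV_local_max[OF assms(1), of e] by (auto simp: dist_real_def abs_minus_commute)
qed

text \<open>The envelopes of a continuous function are the function itself, and where \<open>f (u, \<cdot>) - \<phi>\<close> has a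
  local extremum the derivatives of \<open>\<phi>\<close> and \<open>f (u, \<cdot>)\<close> agree; so both viscosity inequalities hold
  with equality.\<close>

lemma classical_solution_imp_visc_solution:
  fixes X B :: "'a::euclidean_space set"
  assumes "finite X" "B \<subseteq> X" "T > 0" and f: "classical_solution X B T g \<epsilon> P \<psi> f"
  shows "visc_solution X B T g \<epsilon> P \<psi> f"
proof -
  let ?C = "cylinder X T" and ?U = "upper_envelope (cylinder X T) f" and ?L = "lower_envelope (cylinder X T) f"
  have cont: "continuous_on ?C f" by (rule classical_solution_continuous_on[OF assms(1) f])
  have U: "?U z = f z" and L: "?L z = f z" if "z \<in> ?C" for z
    using upper_envelope_continuous[OF cont that] lower_envelope_continuous[OF cont that] by auto
  have "usc_on ?C f" "lsc_on ?C f"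
    using cont by (auto simp: lsc_on_iff_usc_on_uminus intro!: continuous_on_imp_usc_on continuous_on_minus)
  then have sc: "usc_on ?C ?U" "lsc_on ?C ?L"
    using U L unfolding usc_on_def lsc_on_def eventually_at_filter
    by (auto elim!: eventually_mono)
  have grad: "nonlocal_grad g \<epsilon> X ?U u t = nonlocal_grad g \<epsilon> X f u t"
      "nonlocal_grad g \<epsilon> X ?L u t = nonlocal_grad g \<epsilon> X f u t" if "u \<in> X" "t \<in> {0<..<T}" for u t
    using that U L unfolding nonlocal_grad_def
    by (auto simp: cylinder_def intro!: arg_cong[where f = Max] image_cong)
  have near: "\<forall>\<^sub>F s in nhds t. s \<in> {0<..<T}" if "t \<in> {0<..<T}" for t
    using that by (intro eventually_nhds_in_open) auto
  have bdry: "(u, t) \<in> ?C" "f (u, t) = \<psi> u" if "(u, t) \<in> parabolic_boundary X B T" for u t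
    using that f \<open>B \<subseteq> X\<close> \<open>T > 0\<close>
    by (auto simp: parabolic_boundary_def cylinder_def classical_solution_def)
  have eqn: "deriv \<phi> t = - nonlocal_grad g \<epsilon> X f u t + P u"
    if u: "u \<in> X - B" and t: "t \<in> {0<..<T}" and \<phi>: "\<phi> C1_differentiable_on {0<..<T}"
      and ex: "(\<forall>\<^sub>F s in nhds t. f (u, s) - \<phi> s \<le> f (u, t) - \<phi> t) \<or>
        (\<forall>\<^sub>F s in nhds t. f (u, s) - \<phi> s \<ge> f (u, t) - \<phi> t)" for u t \<phi>
  proof -
    let ?l = "- nonlocal_grad g \<epsilon> X f u t + P u - deriv \<phi> t"
    have d: "((\<lambda>s. f (u, s) - \<phi> s) has_real_derivative ?l) (at t)"
      by (intro DERIV_diff classical_solution_deriv[OF f u t] C1_real_has_derivative[OF \<phi> t])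
    have "?l = 0"
      using ex
    proof
      assume "\<forall>\<^sub>F s in nhds t. f (u, s) - \<phi> s \<ge> f (u, t) - \<phi> t"
      then have "- ?l = 0"
        by (intro DERIV_eq_0_at_local_max[OF DERIV_minus[OF d]]) (auto elim: eventually_mono)
      then show ?thesis by simp
    qed (rule DERIV_eq_0_at_local_max[OF d])
    then show ?thesis by simp
  qed
  have "visc_subsol X B T g \<epsilon> P \<psi> ?U"
    unfolding visc_subsol_def visc_subsol_interior_def
  proof (intro conjI ballI allI impI; (elim conjE)?)
    show "usc_on ?C ?U" by (rule sc)
    fix u t \<phi>
    assume u: "u \<in> X - B" and t: "t \<in> {0<..<T}" and \<phi>: "\<phi> C1_differentiable_on {0<..<T}"
      and max: "\<forall>\<^sub>F s in nhds t. ?U (u, s) - \<phi> s \<le> ?U (u, t) - \<phi> t"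
    have "\<forall>\<^sub>F s in nhds t. f (u, s) - \<phi> s \<le> f (u, t) - \<phi> t"
      using max near[OF t] by eventually_elim (use u t U in \<open>auto simp: cylinder_def\<close>)
    then show "deriv \<phi> t \<le> - nonlocal_grad g \<epsilon> X ?U u t + P u"
      using eqn[OF u t \<phi>] grad(1)[of u t] u t by simp
  next
    fix z assume z: "z \<in> parabolic_boundary X B T"
    then show "case z of (u, t) \<Rightarrow> ?U (u, t) \<le> \<psi> u"
      using bdry U by auto
  qed
  moreover have "visc_supersol X B T g \<epsilon> P \<psi> ?L"
    unfolding visc_supersol_def visc_supersol_interior_def
  proof (intro conjI ballI allI impI; (elim conjE)?)
    show "lsc_on ?C ?L" by (rule sc)
    fix u t \<phi>
    assume u: "u \<in> X - B" and t: "t \<in> {0<..<T}" and \<phi>: "\<phi> C1_differentiable_on {0<..<T}"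
      and min: "\<forall>\<^sub>F s in nhds t. ?L (u, s) - \<phi> s \<ge> ?L (u, t) - \<phi> t"
    have "\<forall>\<^sub>F s in nhds t. f (u, s) - \<phi> s \<ge> f (u, t) - \<phi> t"
      using min near[OF t] by eventually_elim (use u t L in \<open>auto simp: cylinder_def\<close>)
    then show "deriv \<phi> t \<ge> - nonlocal_grad g \<epsilon> X ?L u t + P u"
      using eqn[OF u t \<phi>] grad(2)[of u t] u t by simp
  next
    fix z assume z: "z \<in> parabolic_boundary X B T"
    then show "case z of (u, t) \<Rightarrow> ?L (u, t) \<ge> \<psi> u"
      using bdry L by auto
  qed
  ultimately show ?thesis
    using continuous_on_imp_locally_bounded_on[OF cont] by (simp add: visc_solution_def)
qed

section \<open>Comparison with a classical solution\<close>

text \<open>The first contact of \<open>d\<close> with the family \<open>K / (T - s)\<close>: \<open>K\<close> is the maximum of \<open>(T - s) d\<close>. The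
  weight vanishes at \<open>s = T\<close>, so the positive maximum is attained strictly before \<open>T\<close>.\<close>

lemma touching_from_above:
  fixes X :: "'a::euclidean_space set"
  assumes "finite X" and d: "usc_on (cylinder X T) d"
    and "u1 \<in> X" "t1 \<in> {0..<T}" "d (u1, t1) > 0"
  obtains K u t where "K > 0" "u \<in> X" "t \<in> {0..<T}" "d (u, t) = K / (T - t)"
    and "\<And>v s. v \<in> X \<Longrightarrow> s \<in> {0..<T} \<Longrightarrow> d (v, s) \<le> K / (T - s)"
proof -
  let ?w = "\<lambda>z. (T - snd z) * d z"
  have "usc_on (cylinder X T) ?w"
    using d by (intro usc_on_mult_nonneg continuous_intros) (auto simp: cylinder_def)
  moreover have "compact (cylinder X T)"
    unfolding cylinder_def using assms(1) by (intro compact_Times compact_Icc finite_imp_compact)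
  moreover have z1: "(u1, t1) \<in> cylinder X T"
    using assms(3,4) by (auto simp: cylinder_def)
  ultimately obtain z where z: "z \<in> cylinder X T" "\<And>y. y \<in> cylinder X T \<Longrightarrow> ?w y \<le> ?w z"
    using usc_on_attains_sup[of "cylinder X T" ?w] by blast
  obtain u t where ut: "z = (u, t)" by (cases z)
  define K where "K = (T - t) * d (u, t)"
  have "0 < (T - t1) * d (u1, t1)" using assms(4,5) by simp
  also have "\<dots> \<le> K" using z(2)[OF z1] by (simp add: ut K_def)
  finally have K: "K > 0" .
  then have t: "u \<in> X" "t \<in> {0..<T}"
    using z(1) by (auto simp: ut cylinder_def K_def less_le)
  show thesis
  proof (rule that[OF K t])
    show "d (u, t) = K / (T - t)" using t by (simp add: K_def)
    fix v s assume "v \<in> X" "s \<in> {0..<T}"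
    then show "d (v, s) \<le> K / (T - s)"
      using z(2)[of "(v, s)"] by (auto simp: cylinder_def ut K_def field_simps)
  qed
qed

text \<open>At the contact point, \<open>f (u, \<cdot>) + K / (T - \<cdot>)\<close> touches \<open>h (u, \<cdot>)\<close> from above, and comparing the
  values at the other points of \<open>X\<close> with the contact value orders the nonlocal gradients. The equation
  for \<open>f\<close> then cancels against the inequality for \<open>h\<close> except for the penalty term.\<close>

theorem subsol_le_classical_solution:
  fixes X B :: "'a::euclidean_space set"
  assumes "finite X" and ker: "\<And>u v. u \<in> X \<Longrightarrow> v \<in> X \<Longrightarrow> kernel g \<epsilon> u v \<ge> 0"
    and f: "classical_solution X B T g \<epsilon> P \<psi> f" and h: "visc_subsol X B T g \<epsilon> P \<psi> h"
    and "u1 \<in> X" "t1 \<in> {0..<T}"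
  shows "h (u1, t1) \<le> f (u1, t1)"
proof (rule ccontr)
  assume "\<not> ?thesis"
  moreover have "usc_on (cylinder X T) (\<lambda>z. h z + - f z)"
  proof (rule usc_on_add)
    show "usc_on (cylinder X T) h"
      using h by (simp add: visc_subsol_def visc_subsol_interior_def)
    show "usc_on (cylinder X T) (\<lambda>z. - f z)"
      by (intro continuous_on_imp_usc_on continuous_on_minus classical_solution_continuous_on[OF assms(1) f])
  qed
  ultimately obtain K u t where K: "K > 0" and u: "u \<in> X" and t: "t \<in> {0..<T}"
    and touch: "h (u, t) + - f (u, t) = K / (T - t)"
    and above: "\<And>v s. v \<in> X \<Longrightarrow> s \<in> {0..<T} \<Longrightarrow> h (v, s) + - f (v, s) \<le> K / (T - s)"
    using touching_from_above[OF assms(1), of T "\<lambda>z. h z + - f z" u1 t1] assms(5,6) by auto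
  have "h (u, t) > f (u, t)"
    using touch divide_pos_pos[OF K, of "T - t"] t by simp
  moreover have "h (v, s) \<le> f (v, s)" if "v \<in> X" "s \<in> {0..<T}" "s = 0 \<or> v \<in> B" for v s
  proof -
    have "(v, s) \<in> parabolic_boundary X B T"
      using that by (cases "s = 0") (auto simp: parabolic_boundary_def)
    then have "h (v, s) \<le> \<psi> v" using h unfolding visc_subsol_def by blast
    moreover have "f (v, s) = \<psi> v" using f that by (auto simp: classical_solution_def)
    ultimately show ?thesis by simp
  qed
  ultimately have u: "u \<in> X - B" and t: "t \<in> {0<..<T}"
    using u t by (force simp: less_le)+
  let ?\<phi> = "\<lambda>s. f (u, s) + K / (T - s)"
  have "\<forall>\<^sub>F s in nhds t. s \<in> {0<..<T}"
    using t by (intro eventually_nhds_in_open) auto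
  then have "\<forall>\<^sub>F s in nhds t. h (u, s) - ?\<phi> s \<le> h (u, t) - ?\<phi> t"
  proof eventually_elim
    case (elim s)
    then show ?case using touch above[of u s] u by simp
  qed
  then have "deriv ?\<phi> t \<le> - nonlocal_grad g \<epsilon> X h u t + P u"
    using h u t penalised_classical_solution(1)[OF assms(1) f u, of K]
    unfolding visc_subsol_def visc_subsol_interior_def by blast
  moreover have "nonlocal_grad g \<epsilon> X f u t \<le> nonlocal_grad g \<epsilon> X h u t"
  proof (rule nonlocal_grad_mono[OF assms(1)])
    show "kernel g \<epsilon> u v \<ge> 0" if "v \<in> X" for v using ker u that by blast
    show "f (u, t) - f (v, t) \<le> h (u, t) - h (v, t)" if "v \<in> X" for v
      using touch above[OF that, of t] t by simp
  qed (use u in auto)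
  ultimately have "K / (T - t)\<^sup>2 \<le> 0"
    using penalised_classical_solution(2)[OF assms(1) f u t, of K] by simp
  moreover have "K / (T - t)\<^sup>2 > 0" using K t by simp
  ultimately show False by simp
qed

text \<open>The same argument with \<open>f - h\<close> in place of \<open>h - f\<close> and test function \<open>f (u, \<cdot>) - K / (T - \<cdot>)\<close>.
  It is not the previous result applied to \<open>- h\<close>: the maximum in the nonlocal gradient does not
  commute with negation.\<close>

theorem classical_solution_le_supersol:
  fixes X B :: "'a::euclidean_space set"
  assumes "finite X" and ker: "\<And>u v. u \<in> X \<Longrightarrow> v \<in> X \<Longrightarrow> kernel g \<epsilon> u v \<ge> 0"
    and f: "classical_solution X B T g \<epsilon> P \<psi> f" and h: "visc_supersol X B T g \<epsilon> P \<psi> h"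
    and "u1 \<in> X" "t1 \<in> {0..<T}"
  shows "f (u1, t1) \<le> h (u1, t1)"
proof (rule ccontr)
  assume "\<not> ?thesis"
  moreover have "usc_on (cylinder X T) (\<lambda>z. - h z + f z)"
  proof (rule usc_on_add)
    show "usc_on (cylinder X T) (\<lambda>z. - h z)"
      using h by (simp add: visc_supersol_def visc_supersol_interior_def lsc_on_iff_usc_on_uminus)
    show "usc_on (cylinder X T) f"
      by (intro continuous_on_imp_usc_on classical_solution_continuous_on[OF assms(1) f])
  qed
  ultimately obtain K u t where K: "K > 0" and u: "u \<in> X" and t: "t \<in> {0..<T}"
    and touch: "- h (u, t) + f (u, t) = K / (T - t)"
    and above: "\<And>v s. v \<in> X \<Longrightarrow> s \<in> {0..<T} \<Longrightarrow> - h (v, s) + f (v, s) \<le> K / (T - s)"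
    using touching_from_above[OF assms(1), of T "\<lambda>z. - h z + f z" u1 t1] assms(5,6) by auto
  have "h (u, t) < f (u, t)"
    using touch divide_pos_pos[OF K, of "T - t"] t by simp
  moreover have "h (v, s) \<ge> f (v, s)" if "v \<in> X" "s \<in> {0..<T}" "s = 0 \<or> v \<in> B" for v s
  proof -
    have "(v, s) \<in> parabolic_boundary X B T"
      using that by (cases "s = 0") (auto simp: parabolic_boundary_def)
    then have "h (v, s) \<ge> \<psi> v" using h unfolding visc_supersol_def by blast
    moreover have "f (v, s) = \<psi> v" using f that by (auto simp: classical_solution_def)
    ultimately show ?thesis by simp
  qed
  ultimately have u: "u \<in> X - B" and t: "t \<in> {0<..<T}"
    using u t by (force simp: less_le)+
  let ?\<phi> = "\<lambda>s. f (u, s) + - K / (T - s)"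
  have "\<forall>\<^sub>F s in nhds t. s \<in> {0<..<T}"
    using t by (intro eventually_nhds_in_open) auto
  then have "\<forall>\<^sub>F s in nhds t. h (u, s) - ?\<phi> s \<ge> h (u, t) - ?\<phi> t"
  proof eventually_elim
    case (elim s)
    then show ?case using touch above[of u s] u by simp
  qed
  then have "deriv ?\<phi> t \<ge> - nonlocal_grad g \<epsilon> X h u t + P u"
    using h u t penalised_classical_solution(1)[OF assms(1) f u, of "- K"]
    unfolding visc_supersol_def visc_supersol_interior_def by blast
  moreover have "nonlocal_grad g \<epsilon> X h u t \<le> nonlocal_grad g \<epsilon> X f u t"
  proof (rule nonlocal_grad_mono[OF assms(1)])
    show "kernel g \<epsilon> u v \<ge> 0" if "v \<in> X" for v using ker u that by blast
    show "h (u, t) - h (v, t) \<le> f (u, t) - f (v, t)" if "v \<in> X" for v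
      using touch above[OF that, of t] t by simp
  qed (use u in auto)
  ultimately have "- K / (T - t)\<^sup>2 \<ge> 0"
    using penalised_classical_solution(2)[OF assms(1) f u t, of "- K"] by simp
  moreover have "K / (T - t)\<^sup>2 > 0" using K t by simp
  ultimately show False by simp
qed

lemma continuous_on_le_endpoint:
  fixes p q :: "real \<Rightarrow> real"
  assumes "T > 0" "continuous_on {0..T} p" "continuous_on {0..T} q"
    and "\<And>t. t \<in> {0..<T} \<Longrightarrow> p t \<le> q t"
  shows "p T \<le> q T"
proof (rule tendsto_le[OF trivial_limit_at_left_real])
  show "(q \<longlongrightarrow> q T) (at_left T)" "(p \<longlongrightarrow> p T) (at_left T)"
    using assms(1-3) by (auto simp: continuous_on_def simp flip: at_within_Icc_at_left)
  show "\<forall>\<^sub>F t in at_left T. p t \<le> q t"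
    using assms(1,4) by (auto simp: eventually_at_left_field intro!: exI[of _ 0])
qed

section \<open>Well-posedness\<close>

theorem proposition2p12:
  fixes \<Omega> \<Gamma> X B :: "(real ^ 'm) set"
    and P \<psi> \<psi>b :: "real ^ 'm \<Rightarrow> real"
    and g :: "real \<Rightarrow> real"
    and T \<epsilon> r a :: real
  assumes "T > 0" and "\<epsilon> > 0"
    and "compact \<Omega>" and "\<Gamma> \<subseteq> \<Omega>" and "closed \<Gamma>" and "open (\<Omega> - \<Gamma>)"
    and "X \<subseteq> \<Omega>" and "finite X"
    and "B \<subseteq> X" and "B \<noteq> {}" and "X - B \<subseteq> \<Omega> - \<Gamma>"
    and "\<And>u. u \<in> X - B \<Longrightarrow> P u \<ge> 0"
    and "\<exists>L. L-lipschitz_on (X - B) P"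
    and "\<exists>L. L-lipschitz_on X \<psi>"
    and "\<And>t. t \<ge> 0 \<Longrightarrow> g t \<ge> 0"
    and "r > 0" and "closure {t \<in> {0..}. g t \<noteq> 0} \<subseteq> {0..r}"
    and "a \<in> {0<..<r}" and "antimono_on {0..a} g" and "g a > 0"
    and "bdd_above ((\<lambda>t. t * g t) ` {0..})" and "kernel_const g > 0"
    and "\<exists>L. L-lipschitz_on \<Omega> \<psi>b"
    and "\<And>u. u \<in> B \<Longrightarrow> \<psi>b u = \<psi> u"
    and "visc_subsol X B T g \<epsilon> P \<psi> (\<lambda>(u, t). \<psi>b u)"
  shows "\<exists>f :: (real ^ 'm) \<times> real \<Rightarrow> real.
    visc_solution X B T g \<epsilon> P \<psi> f \<and>
    continuous_on (cylinder X T) f \<and>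
    (\<forall>h. visc_solution X B T g \<epsilon> P \<psi> h \<longrightarrow> (\<forall>u\<in>X. \<forall>t\<in>{0..<T}. h (u, t) = f (u, t))) \<and>
    (\<forall>h. visc_solution X B T g \<epsilon> P \<psi> h \<and> continuous_on (cylinder X T) h \<longrightarrow>
       (\<forall>z\<in>cylinder X T. h z = f z)) \<and>
    (\<exists>fbar. (\<exists>L. L-lipschitz_on (cylinder X T) fbar) \<and>
       (\<forall>u\<in>X. \<forall>t\<in>{0..T}. \<psi>b u \<le> f (u, t) \<and> f (u, t) \<le> fbar (u, t)))"
proof -
  have "X \<noteq> {}" using assms(9,10) by auto
  have ker: "kernel g \<epsilon> u v \<ge> 0" for u v :: "real ^ 'm"
    using assms(2,15,22) by (simp add: kernel_def)
  obtain f where f: "classical_solution X B T g \<epsilon> P \<psi> f"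
    using ex_classical_solution[OF \<open>finite X\<close> \<open>X \<noteq> {}\<close> \<open>B \<subseteq> X\<close> \<open>T > 0\<close>] by blast
  have cont: "continuous_on (cylinder X T) f"
    by (rule classical_solution_continuous_on[OF \<open>finite X\<close> f])
  have time_cont: "continuous_on {0..T} (\<lambda>t. h (u, t))"
    if "continuous_on (cylinder X T) h" "u \<in> X" for u h
    using that(1) by (rule continuous_on_compose2)
      (use that(2) in \<open>auto simp: cylinder_def intro: continuous_intros\<close>)
  have unique: "h (u, t) = f (u, t)"
    if h: "visc_solution X B T g \<epsilon> P \<psi> h" and ut: "u \<in> X" "t \<in> {0..<T}" for h u t
  proof -
    let ?C = "cylinder X T"
    have z: "(u, t) \<in> ?C" and lb: "locally_bounded_on ?C h"
      using ut h by (auto simp: cylinder_def visc_solution_def)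
    have "h (u, t) \<le> upper_envelope ?C h (u, t)" by (rule upper_envelope_ge[OF lb z])
    also have "\<dots> \<le> f (u, t)"
      using h ut ker by (intro subsol_le_classical_solution[OF \<open>finite X\<close> _ f]) (auto simp: visc_solution_def)
    finally have "h (u, t) \<le> f (u, t)" .
    moreover have "f (u, t) \<le> lower_envelope ?C h (u, t)"
      using h ut ker by (intro classical_solution_le_supersol[OF \<open>finite X\<close> _ f]) (auto simp: visc_solution_def)
    moreover have "\<dots> \<le> h (u, t)" by (rule lower_envelope_le[OF lb z])
    ultimately show ?thesis by simp
  qed
  have unique_cont: "h z = f z"
    if h: "visc_solution X B T g \<epsilon> P \<psi> h" "continuous_on (cylinder X T) h" and z: "z \<in> cylinder X T" for h z
  proof -
    obtain u t where ut: "z = (u, t)" "u \<in> X" "t \<in> {0..T}" using z by (auto simp: cylinder_def)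
    show ?thesis
    proof (cases "t = T")
      case True
      have "h (u, T) \<le> f (u, T)" "f (u, T) \<le> h (u, T)"
        using continuous_on_le_endpoint[OF \<open>T > 0\<close> time_cont[OF h(2) ut(2)] time_cont[OF cont ut(2)]]
          continuous_on_le_endpoint[OF \<open>T > 0\<close> time_cont[OF cont ut(2)] time_cont[OF h(2) ut(2)]]
          unique[OF h(1) ut(2)] by auto
      then show ?thesis using ut True by simp
    qed (use ut unique[OF h(1)] in auto)
  qed
  have lower: "\<psi>b u \<le> f (u, t)" if u: "u \<in> X" and t: "t \<in> {0..T}" for u t
  proof -
    have before: "\<psi>b u \<le> f (u, s)" if "s \<in> {0..<T}" for s
      using subsol_le_classical_solution[OF \<open>finite X\<close> ker f assms(25) u that] by simp
    have "\<psi>b u \<le> f (u, T)"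
      using continuous_on_le_endpoint[OF \<open>T > 0\<close> continuous_on_const time_cont[OF cont u]] before by blast
    then show ?thesis using before[of t] t by (cases "t = T") auto
  qed
  have "compact (cylinder X T)"
    unfolding cylinder_def using \<open>finite X\<close> by (intro compact_Times compact_Icc finite_imp_compact)
  then have "bounded (f ` cylinder X T)"
    using compact_continuous_image[OF cont] compact_imp_bounded by blast
  then obtain M where M: "\<And>z. z \<in> cylinder X T \<Longrightarrow> \<bar>f z\<bar> \<le> M"
    unfolding bounded_iff by auto
  have upper: "f (u, t) \<le> M" if "u \<in> X" "t \<in> {0..T}" for u t
    using M[of "(u, t)"] that by (auto simp: cylinder_def)
  have "0-lipschitz_on (cylinder X T) (\<lambda>_. M)"
    by (rule lipschitz_intros)
  then have "\<exists>fbar. (\<exists>L. L-lipschitz_on (cylinder X T) fbar) \<and>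
      (\<forall>u\<in>X. \<forall>t\<in>{0..T}. \<psi>b u \<le> f (u, t) \<and> f (u, t) \<le> fbar (u, t))"
    using lower upper by (intro exI[of _ "\<lambda>_. M"]) blast
  moreover have "visc_solution X B T g \<epsilon> P \<psi> f"
    by (rule classical_solution_imp_visc_solution[OF \<open>finite X\<close> \<open>B \<subseteq> X\<close> \<open>T > 0\<close> f])
  ultimately show ?thesis
    using cont unique unique_cont by blast
qed

end
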